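(* Let $t\in\mathbb{R}$ and $0\le\beta\le1$. Then the sequence $E(t,\beta;x)=(E_n(t,\beta;x))_{n\ge0}$ of generalized Apostol-Euler polynomials has associated sequence $\boldsymbol{a(t)}=(a_n(t))_{n\ge0}$ given by $$a_n(t)=(-t)_n\,\beta^n,\qquad n\in\mathbb{N}_0.$$
   Context: $\mathbb{N}_0=\{0,1,2,\dots\}$. $\mathcal{G}$ is the set of real sequences $\boldsymbol{u}=(u_n)_{n\ge0}$ with $u_0\ne0$ and $\sum_{n\ge0}|u_n|r^n/n!<\infty$ for some $r>0$. An Appell sequence is a sequence of real polynomials $A(x)=(A_n(x))_{n\ge0}$ with $(A_n(0))_{n\ge0}\in\mathcal{G}$ and $A_n(x)=\sum_{k=0}^n\binom{n}{k}A_k(0)x^{n-k}$ for all $n\ge0$. With $\Delta^kf(x)=\sum_{j=0}^k\binom{k}{j}(-1)^{k-j}f(x+j)$ and $I_n(x)=x^n$, the sequence associated to an Appell sequence $A(x)$ is the unique $\boldsymbol{a}\in\mathcal{G}$ such that $A_n(x)=\sum_{k=0}^n\frac{a_k}{k!}\Delta^kI_n(x)$ for all $n\in\mathbb{N}_0$ and $x\in\mathbb{R}$. The generalized Apostol-Euler polynomials $E_n(t,\beta;x)$ are defined by $\sum_{n\ge0}E_n(t,\beta;x)\frac{z^n}{n!}=\frac{e^{xz}}{(1+\beta(e^z-1))^t}$ for complex $z$ near $0$ (with the branch of the power equal to $1$ at $z=0$). $(y)_n=y(y-1)\cdots(y-n+1)$ is the falling factorial, with $(y)_0=1$, and $\beta^0=1$.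 *)

theory Defs
  imports "HOL-Complex_Analysis.Complex_Analysis"
begin

definition seqs_G :: "(nat \<Rightarrow> real) set" where
  "seqs_G = {u. u 0 \<noteq> 0 \<and> (\<exists>r>0. summable (\<lambda>n. \<bar>u n\<bar> * r ^ n / fact n))}"

definition appell_seq :: "(nat \<Rightarrow> real poly) \<Rightarrow> bool" where
  "appell_seq A \<longleftrightarrow>
     (\<lambda>n. poly (A n) 0) \<in> seqs_G \<and>
     (\<forall>n x. poly (A n) x = (\<Sum>k\<le>n. real (n choose k) * poly (A k) 0 * x ^ (n - k)))"

definition fwd_diff :: "nat \<Rightarrow> (real \<Rightarrow> real) \<Rightarrow> real \<Rightarrow> real" where
  "fwd_diff k f x = (\<Sum>j\<le>k. real (k choose j) * (-1) ^ (k - j) * f (x + real j))"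

definition represents :: "(nat \<Rightarrow> real) \<Rightarrow> (nat \<Rightarrow> real poly) \<Rightarrow> bool" where
  "represents a A \<longleftrightarrow>
     (\<forall>n x. poly (A n) x = (\<Sum>k\<le>n. a k / fact k * fwd_diff k (\<lambda>y. y ^ n) x))"

definition has_associated_seq :: "(nat \<Rightarrow> real poly) \<Rightarrow> (nat \<Rightarrow> real) \<Rightarrow> bool" where
  "has_associated_seq A a \<longleftrightarrow>
     appell_seq A \<and> a \<in> seqs_G \<and> represents a A \<and>
     (\<forall>b\<in>seqs_G. represents b A \<longrightarrow> b = a)"

text \<open>Near \<open>z = 0\<close> the base of the power is close to 1, so the principal branch used
  by \<^const>\<open>powr\<close> is the branch that equals 1 at \<open>z = 0\<close>. The neighbourhood of 0 may
  depend on \<open>x\<close>.\<close>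

definition apostol_euler_gf :: "real \<Rightarrow> real \<Rightarrow> (nat \<Rightarrow> real poly) \<Rightarrow> bool" where
  "apostol_euler_gf t \<beta> E \<longleftrightarrow>
     (\<forall>x::real. \<forall>\<^sub>F z::complex in nhds 0.
        (\<lambda>n. of_real (poly (E n) x) * z ^ n / fact n) sums
          (exp (of_real x * z) / (1 + of_real \<beta> * (exp z - 1)) powr of_real t))"

definition apostol_euler :: "real \<Rightarrow> real \<Rightarrow> nat \<Rightarrow> real poly" where
  "apostol_euler t \<beta> = (THE E. apostol_euler_gf t \<beta> E)"

definition falling_factorial :: "real \<Rightarrow> nat \<Rightarrow> real" where
  "falling_factorial y n = (\<Prod>i<n. y - real i)"

lemma sums_eventually_unique:
  fixes c d :: "nat \<Rightarrow> complex"
  assumes c: "\<forall>\<^sub>F z in nhds 0. (\<lambda>n. c n * z ^ n) sums f z"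
    and d: "\<forall>\<^sub>F z in nhds 0. (\<lambda>n. d n * z ^ n) sums f z"
  shows "c = d"
proof -
  have *: "f has_fps_expansion Abs_fps u"
    if u: "\<forall>\<^sub>F z in nhds 0. (\<lambda>n. u n * z ^ n) sums f z" for u :: "nat \<Rightarrow> complex"
  proof -
    from u obtain e where e: "e > 0" "\<And>z. dist z 0 < e \<Longrightarrow> (\<lambda>n. u n * z ^ n) sums f z"
      unfolding eventually_nhds_metric by blast
    have "summable (\<lambda>n. u n * of_real (e/2) ^ n)"
      using e(2)[of "of_real (e/2)"] e(1) by (auto simp: sums_iff)
    hence "conv_radius u \<ge> ereal (norm (of_real (e/2) :: complex))"
      by (rule conv_radius_geI)
    moreover have "ereal (norm (of_real (e/2) :: complex)) > 0" using e(1) by simp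
    ultimately have "conv_radius u > 0" by (rule less_le_trans[rotated])
    hence "fps_conv_radius (Abs_fps u) > 0"
      by (simp add: fps_conv_radius_def)
    moreover have "\<forall>\<^sub>F z in nhds 0. eval_fps (Abs_fps u) z = f z"
      using u by eventually_elim (simp add: eval_fps_def sums_iff)
    ultimately show ?thesis by (simp add: has_fps_expansion_def)
  qed
  have "c n = d n" for n
    using fps_nth_fps_expansion[OF *[OF c], of n] fps_nth_fps_expansion[OF *[OF d], of n] by simp
  thus ?thesis by (rule ext)
qed

lemma has_fps_expansion_imp_sums_eventually:
  fixes F :: "complex fps"
  assumes "f has_fps_expansion F"
  shows "\<forall>\<^sub>F z in nhds 0. (\<lambda>n. fps_nth F n * z ^ n) sums f z"
proof -
  have "\<forall>\<^sub>F z in nhds 0. z \<in> eball 0 (fps_conv_radius F)"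
    using assms by (intro eventually_nhds_in_open) (auto simp: has_fps_expansion_def zero_ereal_def)
  moreover have "\<forall>\<^sub>F z in nhds 0. eval_fps F z = f z"
    using assms by (simp add: has_fps_expansion_def)
  ultimately show ?thesis
    by eventually_elim (use sums_eval_fps in \<open>force simp: in_eball_iff\<close>)
qed

lemma fps_compose_nth_in_Reals:
  fixes F G :: "complex fps"
  assumes F: "\<And>n. fps_nth F n \<in> \<real>" and G: "\<And>n. fps_nth G n \<in> \<real>"
  shows "fps_nth (F oo G) n \<in> \<real>"
proof -
  have "fps_nth (G ^ k) n \<in> \<real>" for k n
    by (induction k arbitrary: n)
       (auto simp: fps_one_nth fps_mult_nth intro!: Reals_mult G sum_in_Reals)
  thus ?thesis unfolding fps_compose_nth by (intro sum_in_Reals Reals_mult F)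
qed

lemma apostol_euler_gf_ex1: "\<exists>!E. apostol_euler_gf t \<beta> E"
proof -
  define H :: "complex fps" where
    "H = fps_binomial (- of_real t) oo (fps_const (of_real \<beta>) * (fps_exp 1 - 1))"
  have "((\<lambda>w. (1 + w) powr (- of_real t)) \<circ> (\<lambda>z. of_real \<beta> * (exp z - 1)))
          has_fps_expansion H"
    unfolding H_def
    by (intro has_fps_expansion_compose fps_expansion_intros has_fps_expansion_cmult_left
          has_fps_expansion_diff has_fps_expansion_exp1) simp
  hence H: "(\<lambda>z. (1 + of_real \<beta> * (exp z - 1)) powr (- of_real t)) has_fps_expansion H"
    by (simp add: o_def)
  have H_real: "fps_nth H n \<in> \<real>" for n
    unfolding H_def
  proof (rule fps_compose_nth_in_Reals)
    fix n
    have "(- of_real t :: complex) gchoose n = of_real ((- t) gchoose n)"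
      by (simp add: gbinomial_prod_rev)
    thus "fps_nth (fps_binomial (- of_real t :: complex)) n \<in> \<real>" by simp
    have "(fact n :: complex) = of_real (fact n)" by simp
    thus "fps_nth (fps_const (of_real \<beta>) * (fps_exp 1 - 1 :: complex fps)) n \<in> \<real>"
      by (auto simp del: of_real_fact intro!: Reals_mult Reals_diff Reals_divide)
  qed
  define E :: "nat \<Rightarrow> real poly" where
    "E n = (\<Sum>k\<le>n. monom (fact n / fact k * Re (fps_nth H (n - k))) k)" for n
  have E: "of_real (poly (E n) x) / fact n = fps_nth (fps_exp (of_real x) * H) n" for n x
  proof -
    have "of_real (poly (E n) x) / fact n
            = (\<Sum>k\<le>n. of_real x ^ k / fact k * of_real (Re (fps_nth H (n - k))) :: complex)"
      by (simp add: E_def poly_sum poly_monom sum_divide_distrib field_simps)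
    also have "\<dots> = (\<Sum>k\<le>n. of_real x ^ k / fact k * fps_nth H (n - k))"
      using H_real by (simp add: of_real_Re)
    also have "\<dots> = fps_nth (fps_exp (of_real x) * H) n"
      by (simp add: fps_mult_nth atLeast0AtMost)
    finally show ?thesis .
  qed
  have "apostol_euler_gf t \<beta> E"
    unfolding apostol_euler_gf_def
  proof
    fix x :: real
    have "(\<lambda>z. exp (of_real x * z) * (1 + of_real \<beta> * (exp z - 1)) powr (- of_real t))
            has_fps_expansion fps_exp (of_real x) * H"
      by (intro has_fps_expansion_mult has_fps_expansion_exp H)
    from has_fps_expansion_imp_sums_eventually[OF this]
    show "\<forall>\<^sub>F z::complex in nhds 0.
        (\<lambda>n. of_real (poly (E n) x) * z ^ n / fact n) sums
          (exp (of_real x * z) / (1 + of_real \<beta> * (exp z - 1)) powr of_real t)"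
      unfolding E[symmetric]
      by (simp add: powr_minus field_simps)
  qed
  moreover have "E1 = E2" if "apostol_euler_gf t \<beta> E1" "apostol_euler_gf t \<beta> E2" for E1 E2
  proof
    fix n
    have "poly (E1 n) x = poly (E2 n) x" for x
    proof -
      have "(\<lambda>n. of_real (poly (E1 n) x) / fact n) = (\<lambda>n. of_real (poly (E2 n) x) / fact n :: complex)"
        by (rule sums_eventually_unique[where f = "\<lambda>z. exp (of_real x * z) /
                (1 + of_real \<beta> * (exp z - 1)) powr of_real t"])
           (use that in \<open>simp_all add: apostol_euler_gf_def\<close>)
      thus ?thesis by (auto dest: fun_cong[of _ _ n])
    qed
    thus "E1 n = E2 n" by (metis poly_eq_poly_eq_iff ext)
  qed
  ultimately show ?thesis by blast
qed

lemma apostol_euler_gf: "apostol_euler_gf t \<beta> (apostol_euler t \<beta>)"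
  unfolding apostol_euler_def by (rule theI'[OF apostol_euler_gf_ex1])

end

theory Submission
  imports Defs
begin

text \<open>
  Everything is read off from exponential generating functions. By the binomial theorem,
  \<open>e^(x z) (e^z - 1)^k = (\<Sum>j\<le>k. (k choose j) (-1)^(k-j) e^((x + j) z))\<close>, whose coefficient
  at \<open>z^n / n!\<close> is the \<open>k\<close>-th forward difference of \<open>y^n\<close> at \<open>x\<close>
  (\<open>fps_exp_mult_exp_minus_1_power_nth\<close>). Hence a representation
  \<open>A_n(x) = (\<Sum>k\<le>n. a_k / k! \<Delta>^k I_n(x))\<close> says exactly that the generating function of
  the \<open>A_n(x)\<close> is \<open>e^(x z) f(e^z - 1)\<close> with \<open>f(w) = (\<Sum>k. a_k w^k / k!)\<close>. For the
  Apostol-Euler polynomials \<open>f(w) = (1 + \<beta> w)^(-t)\<close>, and the binomial series gives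
  \<open>a_k / k! = (-t gchoose k) \<beta>^k\<close>, that is \<open>a_k = (-t)_k \<beta>^k\<close>.

  The other requirements follow from the same picture. The factor \<open>e^(x z)\<close> gives the Appell
  identity; convergence of the generating function near 0, and of the binomial series in the
  unit disc, gives the growth conditions; and the coefficients \<open>a_k\<close> are unique because
  \<open>(e^z - 1)^k\<close> has leading term \<open>z^k\<close>, so that the linear system for them is triangular.
\<close>

lemma fps_exp_mult_exp_minus_1_power_nth:
  "fps_nth (fps_exp (of_real x) * (fps_exp 1 - 1) ^ k) n
     = (of_real (fwd_diff k (\<lambda>y. y ^ n) x) / fact n :: complex)"
proof -
  have "(fps_exp 1 - 1 :: complex fps) ^ k
          = (\<Sum>j\<le>k. of_nat (k choose j) * fps_exp 1 ^ j * (- 1) ^ (k - j))"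
    using binomial_ring[of "fps_exp 1 :: complex fps" "- 1" k] by simp
  hence "fps_exp (of_real x :: complex) * (fps_exp 1 - 1) ^ k
          = (\<Sum>j\<le>k. fps_const (of_nat (k choose j) * (- 1) ^ (k - j)) * fps_exp (of_real (x + real j)))"
    by (simp add: sum_distrib_left fps_exp_add_mult fps_exp_power_mult fps_of_nat
          flip: fps_const_mult fps_const_power fps_const_neg)
       (simp add: mult_ac)
  thus ?thesis
    by (simp add: fps_sum_nth fwd_diff_def sum_divide_distrib)
qed

lemma fwd_diff_power_same_degree: "fwd_diff n (\<lambda>y. y ^ n) 0 = fact n"
proof -
  have "fps_nth ((fps_exp 1 - 1 :: complex fps) ^ n) n = 1"
    by (simp add: startsby_zero_power_nth_same)
  hence "of_real (fwd_diff n (\<lambda>y. y ^ n) 0) = (of_real (fact n) :: complex)"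
    using fps_exp_mult_exp_minus_1_power_nth[of 0 n n] by (simp add: field_simps)
  thus ?thesis by (simp only: of_real_eq_iff)
qed

text \<open>The equations of index \<open>n\<close> involve only the coefficients up to \<open>n\<close>, the last one with
  the factor \<open>fwd_diff n (\<lambda>y. y ^ n) 0 / fact n = 1\<close>; this triangular system has
  at most one solution.\<close>

lemma represents_unique:
  assumes "represents a A" and "represents b A"
  shows "a = b"
proof
  fix n
  show "a n = b n"
  proof (induction n rule: less_induct)
    case (less n)
    have expand: "poly (A n) 0 = (\<Sum>k<n. c k / fact k * fwd_diff k (\<lambda>y. y ^ n) 0) + c n"
      if "represents c A" for c
      using that unfolding represents_def
      by (simp add: fwd_diff_power_same_degree flip: lessThan_Suc_atMost)
    have "(\<Sum>k<n. a k / fact k * fwd_diff k (\<lambda>y. y ^ n) 0)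
            = (\<Sum>k<n. b k / fact k * fwd_diff k (\<lambda>y. y ^ n) 0)"
      using less by (intro sum.cong) auto
    with expand[OF assms(1)] expand[OF assms(2)] show ?case by simp
  qed
qed

text \<open>The generating function is specified by its values near 0. Passing to formal power
  series turns all later identities into comparisons of coefficients.\<close>

lemma apostol_euler_conv_fps_nth:
  "(of_real (poly (apostol_euler t \<beta> n) x) / fact n :: complex)
     = fps_nth (fps_exp (of_real x) *
         (fps_binomial (- of_real t) oo (fps_const (of_real \<beta>) * (fps_exp 1 - 1)))) n"
proof -
  define H :: "complex fps" where
    "H = fps_binomial (- of_real t) oo (fps_const (of_real \<beta>) * (fps_exp 1 - 1))"
  have "((\<lambda>w. (1 + w) powr (- of_real t)) \<circ> (\<lambda>z. of_real \<beta> * (exp z - 1)))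
          has_fps_expansion H"
    unfolding H_def
    by (intro has_fps_expansion_compose fps_expansion_intros has_fps_expansion_cmult_left
          has_fps_expansion_diff has_fps_expansion_exp1) simp
  hence "(\<lambda>z. exp (of_real x * z) * (1 + of_real \<beta> * (exp z - 1)) powr (- of_real t))
            has_fps_expansion fps_exp (of_real x) * H"
    by (intro has_fps_expansion_mult has_fps_expansion_exp) (simp add: o_def)
  hence "\<forall>\<^sub>F z in nhds 0. (\<lambda>n. fps_nth (fps_exp (of_real x) * H) n * z ^ n) sums
           (exp (of_real x * z) / (1 + of_real \<beta> * (exp z - 1)) powr of_real t)"
    using has_fps_expansion_imp_sums_eventually
    by (fastforce simp: powr_minus field_simps)
  moreover have "\<forall>\<^sub>F z in nhds 0.
      (\<lambda>n. of_real (poly (apostol_euler t \<beta> n) x) / fact n * z ^ n) sums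
        (exp (of_real x * z) / (1 + of_real \<beta> * (exp z - 1)) powr of_real t :: complex)"
    using apostol_euler_gf[of t \<beta>] by (simp add: apostol_euler_gf_def)
  ultimately have "(\<lambda>n. of_real (poly (apostol_euler t \<beta> n) x) / fact n)
                     = fps_nth (fps_exp (of_real x) * H)"
    by (intro sums_eventually_unique)
  thus ?thesis
    unfolding H_def by (rule fun_cong)
qed

lemma apostol_euler_appell_identity:
  "poly (apostol_euler t \<beta> n) x
     = (\<Sum>k\<le>n. real (n choose k) * poly (apostol_euler t \<beta> k) 0 * x ^ (n - k))"
proof -
  define H :: "complex fps" where
    "H = fps_binomial (- of_real t) oo (fps_const (of_real \<beta>) * (fps_exp 1 - 1))"
  have H: "fps_nth H k = of_real (poly (apostol_euler t \<beta> k) 0) / fact k" for k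
    using apostol_euler_conv_fps_nth[of t \<beta> k 0] by (simp add: H_def)
  have "of_real (poly (apostol_euler t \<beta> n) x) = fact n * fps_nth (H * fps_exp (of_real x)) n"
    using apostol_euler_conv_fps_nth[of t \<beta> n x] by (simp add: H_def field_simps)
  also have "\<dots> = (\<Sum>k\<le>n. fact n * (of_real (poly (apostol_euler t \<beta> k) 0) / fact k *
                     (of_real x ^ (n - k) / fact (n - k))))"
    by (simp add: fps_mult_nth atLeast0AtMost H sum_distrib_left)
  also have "\<dots> = of_real (\<Sum>k\<le>n. real (n choose k) * poly (apostol_euler t \<beta> k) 0 * x ^ (n - k))"
    by (simp add: binomial_fact field_simps)
  finally show ?thesis by (simp only: of_real_eq_iff)
qed

text \<open>At \<open>x = 0\<close> the generating function converges in a neighbourhood of 0, hence absolutely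
  in any smaller disc, and takes the value 1 at 0.\<close>

lemma apostol_euler_at_0_in_seqs_G: "(\<lambda>n. poly (apostol_euler t \<beta> n) 0) \<in> seqs_G"
proof -
  define c :: "nat \<Rightarrow> complex" where "c n = of_real (poly (apostol_euler t \<beta> n) 0) / fact n" for n
  have "\<forall>\<^sub>F z in nhds 0. summable (\<lambda>n. c n * z ^ n)"
    using spec[OF apostol_euler_gf[of t \<beta>, unfolded apostol_euler_gf_def], of 0]
    by eventually_elim (auto simp: c_def sums_iff)
  then obtain e where e: "e > 0" "\<And>z. dist z 0 < e \<Longrightarrow> summable (\<lambda>n. c n * z ^ n)"
    unfolding eventually_nhds_metric by blast
  have "summable (\<lambda>n. norm (c n * of_real (e / 4) ^ n))"
    by (rule powser_insidea[of c "of_real (e / 2)"]) (use e in auto)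
  hence "summable (\<lambda>n. \<bar>poly (apostol_euler t \<beta> n) 0\<bar> * (e / 4) ^ n / fact n)"
    using e(1) by (simp add: c_def norm_mult norm_divide norm_power)
  moreover have "poly (apostol_euler t \<beta> 0) 0 \<noteq> 0"
    using apostol_euler_conv_fps_nth[of t \<beta> 0 0] by auto
  ultimately show ?thesis
    using e(1) unfolding seqs_G_def by (auto intro!: exI[of _ "e / 4"])
qed

lemma falling_factorial_conv_gbinomial: "falling_factorial y n = fact n * (y gchoose n)"
  by (simp add: falling_factorial_def gbinomial_prod_rev atLeast0LessThan)

text \<open>The \<open>m\<close>-th coefficient of \<open>F oo G\<close> is a sum over \<open>k \<le> m\<close>. Since \<open>G ^ k\<close> has no terms
  of degree below \<open>k\<close>, for \<open>m \<le> n\<close> this sum may be extended to \<open>k \<le> n\<close>; its range is then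
  independent of \<open>m\<close>, so it can be exchanged with the sum of the product with \<open>A\<close>.\<close>

lemma fps_mult_compose_nth:
  fixes A F G :: "'a :: comm_ring_1 fps"
  assumes "fps_nth G 0 = 0"
  shows "fps_nth (A * (F oo G)) n = (\<Sum>k\<le>n. fps_nth F k * fps_nth (A * G ^ k) n)"
proof -
  have "fps_nth (F oo G) m = (\<Sum>k\<le>n. fps_nth F k * fps_nth (G ^ k) m)" if "m \<le> n" for m
    unfolding fps_compose_nth
    by (rule sum.mono_neutral_left) (use that startsby_zero_power_prefix[OF assms] in auto)
  hence "fps_nth (A * (F oo G)) n
           = (\<Sum>i\<le>n. \<Sum>k\<le>n. fps_nth F k * (fps_nth A i * fps_nth (G ^ k) (n - i)))"
    by (simp add: fps_mult_nth atLeast0AtMost sum_distrib_left mult_ac)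
  also have "\<dots> = (\<Sum>k\<le>n. fps_nth F k * fps_nth (A * G ^ k) n)"
    by (subst sum.swap) (simp add: fps_mult_nth atLeast0AtMost sum_distrib_left)
  finally show ?thesis .
qed

lemma apostol_euler_represented:
  "represents (\<lambda>n. falling_factorial (- t) n * \<beta> ^ n) (apostol_euler t \<beta>)"
  unfolding represents_def
proof (intro allI)
  fix n x
  let ?D = "\<lambda>k. fwd_diff k (\<lambda>y. y ^ n) x"
  have gb: "(- of_real t :: complex) gchoose k = of_real ((- t) gchoose k)" for k
    by (simp add: gbinomial_prod_rev)
  have nth: "fps_nth (fps_exp (of_real x) * (fps_const (of_real \<beta>) * (fps_exp 1 - 1)) ^ k) n
          = of_real \<beta> ^ k * (of_real (?D k) / fact n :: complex)" for k
    using fps_exp_mult_exp_minus_1_power_nth[of x k n]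
    by (simp add: power_mult_distrib mult.left_commute[of "fps_exp _"])
  have "of_real (poly (apostol_euler t \<beta> n) x) / fact n
          = (\<Sum>k\<le>n. of_real ((- t) gchoose k) * (of_real \<beta> ^ k * (of_real (?D k) / fact n)) :: complex)"
    unfolding apostol_euler_conv_fps_nth by (subst fps_mult_compose_nth) (simp_all add: nth gb)
  also have "\<dots> = of_real (\<Sum>k\<le>n. falling_factorial (- t) k * \<beta> ^ k / fact k * ?D k) / fact n"
    by (simp add: falling_factorial_conv_gbinomial sum_divide_distrib mult_ac)
  finally show "poly (apostol_euler t \<beta> n) x
                  = (\<Sum>k\<le>n. falling_factorial (- t) k * \<beta> ^ k / fact k * ?D k)"
    by (simp del: of_real_sum)
qed

lemma falling_factorial_power_in_seqs_G:
  assumes "0 \<le> \<beta>" and "\<beta> \<le> 1"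
  shows "(\<lambda>n. falling_factorial y n * \<beta> ^ n) \<in> seqs_G"
proof -
  \<comment> \<open>Any radius below 1 keeps \<open>\<beta> r\<close> inside the disc of convergence of the binomial series.\<close>
  have "summable (\<lambda>n. norm ((y gchoose n) * (\<beta> / 2) ^ n))"
    by (rule abs_summable_in_conv_radius) (use assms in \<open>auto simp: conv_radius_gchoose\<close>)
  hence "summable (\<lambda>n. \<bar>falling_factorial y n * \<beta> ^ n\<bar> * (1 / 2) ^ n / fact n)"
    using assms
    by (simp add: falling_factorial_conv_gbinomial abs_mult power_divide power_abs mult_ac)
  moreover have "falling_factorial y 0 * \<beta> ^ 0 \<noteq> 0"
    by (simp add: falling_factorial_def)
  ultimately show ?thesis
    unfolding seqs_G_def by (auto intro!: exI[of _ "1 / 2"])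
qed

theorem theorem7:
  fixes t \<beta> :: real
  assumes "0 \<le> \<beta>" and "\<beta> \<le> 1"
  shows "has_associated_seq (apostol_euler t \<beta>) (\<lambda>n. falling_factorial (- t) n * \<beta> ^ n)"
  unfolding has_associated_seq_def appell_seq_def
  using apostol_euler_at_0_in_seqs_G apostol_euler_appell_identity apostol_euler_represented
    falling_factorial_power_in_seqs_G[OF assms] represents_unique
  by blast

end
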